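(* Consider a round of the algorithm $\mathit{DynSlk\text{-}KwnDst}$ (described in the context) that starts with current threshold $N>\beta k\ln\frac{k}{\delta}$, $\beta=2(\sqrt2+2/3)^2$, with $t=N-(\sqrt2+\frac23)\sqrt{kN\ln\frac{k}{\delta}}$. With probability at least $1-\delta$, fewer than $k$ notifications are sent from the players during the arrival of the first $t$ items of this round.
   Context: Distributed Tracking (DT) problem: a coordinator and $k$ players with two-way channels; the coordinator holds a threshold $N$, player $i\in[k]$ holds a counter $n_i$; items arrive one at a time, each incrementing exactly one player's counter; the coordinator must raise an alarm exactly when the $N$-th item arrives. Multinomial arrival model: independently for each item, it arrives at player $i$ with probability $\mu_i$, $\mu_i\ge0$, $\sum_i\mu_i=1$, the $\mu_i$ known. $\delta\in(0,1)$; $\ln$ is the natural logarithm. Algorithm $\mathit{DynSlk\text{-}KwnDst}$ runs in rounds; at the start of a round with current threshold $N$ all counters are reset to $0$; if $N\le4k$ it runs the straightforward algorithm (one message per counter increment); else if $N\le\beta k\ln\frac{k}{\delta}$ it runs the CMY algorithm; otherwise the coordinator sends to each player $i$ the pair $(b_i,s_i)$ with $b_i=\mu_i t$ and $s_i=\lfloor\frac{N-t}{2k}\rfloor$; player $i$ sends a notification for every increase of $s_i$ of its counter beyond $b_i$, i.e. its $j$-th notification is sent when $n_i$ reaches $b_i+js_i$ ($j=1,2,\dots$); upon the $k$-th notification (in total over all players) the coordinator collects all counters, subtracts their sum from $N$, raises the alarm if $N=0$ and otherwise starts a new round. *)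

theory Defs
  imports "HOL-Probability.Probability"
begin

text \<open>
  Players are \<open>1, \<dots>, k\<close> and the items of a round are numbered \<open>1, 2, \<dots>\<close>; \<open>X m \<omega>\<close> is the player at
  which item \<open>m\<close> arrives. The codomain \<open>count_space {1..k}\<close> makes every item arrive at a player.
\<close>

definition multinomial_arrivals ::
  "'a measure \<Rightarrow> nat \<Rightarrow> (nat \<Rightarrow> real) \<Rightarrow> (nat \<Rightarrow> 'a \<Rightarrow> nat) \<Rightarrow> bool" where
  "multinomial_arrivals M k \<mu> X \<longleftrightarrow>
     prob_space M \<and>
     (\<forall>i\<in>{1..k}. \<mu> i \<ge> 0) \<and> (\<Sum>i\<in>{1..k}. \<mu> i) = 1 \<and>
     prob_space.indep_vars M (\<lambda>_. count_space {1..k}) X {1..} \<and>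
     (\<forall>m\<ge>1. \<forall>i\<in>{1..k}. measure M {\<omega> \<in> space M. X m \<omega> = i} = \<mu> i)"

definition counter :: "(nat \<Rightarrow> nat) \<Rightarrow> nat \<Rightarrow> nat \<Rightarrow> nat" where
  "counter x i m = card {l \<in> {1..m}. x l = i}"

definition baseline :: "(nat \<Rightarrow> real) \<Rightarrow> real \<Rightarrow> nat \<Rightarrow> real" where
  "baseline \<mu> t i = \<mu> i * t"

definition slack :: "nat \<Rightarrow> nat \<Rightarrow> real \<Rightarrow> int" where
  "slack k N t = \<lfloor>(real N - t) / (2 * real k)\<rfloor>"

text \<open>
  Counter value \<open>n\<close> meets the condition for the \<open>j\<close>-th notification of a player with parameters
  \<open>(b, s)\<close>. For \<open>s \<ge> 1\<close> and \<open>j \<ge> 1\<close> the conjunct \<open>b < n\<close> is redundant. It only settles the degenerate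
  slack \<open>s = 0\<close>: notifications are for increases beyond \<open>b\<close>, so none is due while \<open>n \<le> b\<close>,
  and all (infinitely many) are due at once when \<open>n > b\<close>.
\<close>

definition notification_due :: "real \<Rightarrow> int \<Rightarrow> nat \<Rightarrow> nat \<Rightarrow> bool" where
  "notification_due b s n j \<longleftrightarrow> b < real n \<and> b + real j * real_of_int s \<le> real n"

text \<open>
  The \<open>j\<close>-th notification of player \<open>i\<close> is sent at the arrival of item \<open>r\<close>, whose increment is
  the one that makes it due.
\<close>

definition sent_at ::
  "(nat \<Rightarrow> real) \<Rightarrow> int \<Rightarrow> (nat \<Rightarrow> nat) \<Rightarrow> nat \<Rightarrow> nat \<Rightarrow> nat \<Rightarrow> bool" where
  "sent_at b s x i j r \<longleftrightarrow>
     notification_due (b i) s (counter x i r) j \<and>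
     \<not> notification_due (b i) s (counter x i (r - 1)) j"

text \<open>
  The notifications (player, ordinal) sent by all players during the first \<open>m\<close> items. The end of
  the round upon the \<open>k\<close>-th notification is not modelled here: it does not affect whether fewer
  than \<open>k\<close> notifications are sent.
\<close>

definition notifications ::
  "nat \<Rightarrow> (nat \<Rightarrow> real) \<Rightarrow> int \<Rightarrow> (nat \<Rightarrow> nat) \<Rightarrow> nat \<Rightarrow> (nat \<times> nat) set" where
  "notifications k b s x m =
     {(i, j). i \<in> {1..k} \<and> j \<ge> 1 \<and> (\<exists>r\<in>{1..m}. sent_at b s x i j r)}"

end

theory Submission
  imports Defs
begin

text \<open>
  If \<open>k\<close> notifications are sent during the first \<open>m = \<lfloor>t\<rfloor>\<close> items, then the players \<open>i\<close> whose counter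
  exceeds its baseline \<open>\<mu>\<^sub>i t\<close> form a set \<open>A\<close> whose total excess is at least \<open>k s > (N - t) / 2 - k\<close>.
  The number of items arriving in a fixed set \<open>A\<close> is a sum of \<open>m\<close> independent indicators, so
  Hoeffding's inequality bounds this probability by \<open>(\<delta> / k)\<^sup>k\<close>, and a union bound over the \<open>2\<^sup>k\<close>
  sets \<open>A\<close> gives at most \<open>(2 \<delta> / k)\<^sup>k \<le> \<delta>\<close> for \<open>k \<ge> 2\<close>. For \<open>k = 1\<close> no notification is sent at all.
\<close>

section \<open>Counters and notifications of a fixed arrival sequence\<close>

lemma counter_le: "counter x i m \<le> m"
proof -
  have "card {l \<in> {1..m}. x l = i} \<le> card {1..m}"
    by (intro card_mono) auto
  thus ?thesis
    by (simp add: counter_def)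
qed

lemma counter_mono: "r \<le> m \<Longrightarrow> counter x i r \<le> counter x i m"
  unfolding counter_def by (intro card_mono) auto

lemma counter_cong: "(\<And>l. l \<in> {1..m} \<Longrightarrow> x l = y l) \<Longrightarrow> r \<le> m \<Longrightarrow> counter x i r = counter y i r"
  unfolding counter_def by (intro arg_cong[of _ _ card]) auto

text \<open>Double counting: the load of a set of players becomes a sum over items, the form to
  which Hoeffding's inequality applies.\<close>

lemma sum_counter:
  assumes "finite A"
  shows "(\<Sum>i\<in>A. real (counter x i m)) = (\<Sum>l\<in>{1..m}. indicator A (x l))"
proof -
  have "(\<Sum>i\<in>A. real (counter x i m)) = (\<Sum>i\<in>A. \<Sum>l\<in>{1..m}. indicator {i} (x l))"
    by (simp add: counter_def indicator_def sum.If_cases Int_def)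
  also have "\<dots> = (\<Sum>l\<in>{1..m}. \<Sum>i\<in>A. indicator {i} (x l))"
    by (rule sum.swap)
  also have "\<dots> = (\<Sum>l\<in>{1..m}. indicator A (x l))"
    using assms by (intro sum.cong) (auto simp: indicator_def sum.delta)
  finally show ?thesis .
qed

lemma notifications_cong:
  assumes "\<And>l. l \<in> {1..m} \<Longrightarrow> x l = y l"
  shows "notifications k b s x m = notifications k b s y m"
proof -
  have *: "counter x i r = counter y i r" if "r \<le> m" for i r
    using counter_cong[of m x y r] assms that by blast
  have "sent_at b s x i j r \<longleftrightarrow> sent_at b s y i j r" if "r \<in> {1..m}" for i j r
  proof -
    have "r \<le> m" "r - 1 \<le> m" using that by auto
    then show ?thesis unfolding sent_at_def by (simp only: *)
  qed
  then show ?thesis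
    unfolding notifications_def by blast
qed

text \<open>Counters never decrease, so a condition met at some item still holds at item
  \<open>m\<close>; only the final counters matter.\<close>

lemma notification_dueD:
  assumes "(i, j) \<in> notifications k b s x m"
  shows "notification_due (b i) s (counter x i m) j"
proof -
  from assms obtain r where "r \<le> m" "notification_due (b i) s (counter x i r) j"
    by (auto simp: notifications_def sent_at_def)
  moreover from this have "real (counter x i r) \<le> real (counter x i m)"
    by (simp add: counter_mono)
  ultimately show ?thesis
    by (auto simp: notification_due_def)
qed

text \<open>A player above its baseline sends at most excess divided by \<open>s\<close>
  notifications, and any other player sends none. Summing over the players above baseline bounds the
  number of notifications times \<open>s\<close> by their total excess. Which players these are
  varies with \<open>x\<close>, so the bound is assumed for every \<open>A\<close>.\<close>

lemma few_notifications:
  assumes s: "s > 0"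
    and *: "\<And>A. A \<subseteq> {1..k} \<Longrightarrow> (\<Sum>i\<in>A. real (counter x i m) - b i) < real k * of_int s"
  shows "finite (notifications k b s x m) \<and> card (notifications k b s x m) < k"
proof -
  define A where "A = {i \<in> {1..k}. b i < real (counter x i m)}"
  define q where "q i = nat \<lfloor>(real (counter x i m) - b i) / of_int s\<rfloor>" for i
  define B where "B = (SIGMA i:A. {1..q i})"
  have sub: "notifications k b s x m \<subseteq> B"
  proof (clarify, goal_cases)
    case (1 i j)
    have ij: "i \<in> {1..k}" "j \<ge> 1"
      using 1 by (auto simp: notifications_def)
    have due: "b i < real (counter x i m)" "b i + real j * of_int s \<le> real (counter x i m)"
      using notification_dueD[OF 1] by (auto simp: notification_due_def)
    have "real j \<le> (real (counter x i m) - b i) / of_int s"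
      using due s by (simp add: field_simps)
    then have "j \<le> q i"
      unfolding q_def by linarith
    then show ?case
      using ij due by (simp add: B_def A_def)
  qed
  have finB: "finite B"
    by (simp add: B_def A_def)
  have "real (card B) * of_int s = (\<Sum>i\<in>A. real (q i) * of_int s)"
    by (simp add: B_def A_def sum_distrib_right)
  also have "\<dots> \<le> (\<Sum>i\<in>A. real (counter x i m) - b i)"
  proof (rule sum_mono)
    \<comment> \<open>Nonnegativity matters here: \<open>nat\<close> would raise a negative floor to
      0 and break the upper bound on \<open>q i\<close>.\<close>
    fix i assume "i \<in> A"
    then have "(real (counter x i m) - b i) / of_int s \<ge> 0"
      using s by (simp add: A_def)
    then have "real (q i) \<le> (real (counter x i m) - b i) / of_int s"
      unfolding q_def by linarith
    then show "real (q i) * of_int s \<le> real (counter x i m) - b i"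
      using s by (simp add: field_simps)
  qed
  also have "\<dots> < real k * of_int s"
    by (rule *) (auto simp: A_def)
  finally have "card B < k"
    using s by simp
  then show ?thesis
    using card_mono[OF finB sub] finite_subset[OF sub finB] by simp
qed

section \<open>Concentration and measurability for random arrivals\<close>

lemma multinomial_arrivals_tail:
  assumes arr: "multinomial_arrivals M k \<mu> X" and A: "A \<subseteq> {1..k}" and "\<epsilon> \<ge> 0" "m \<ge> 1"
  shows "measure M {\<omega> \<in> space M. (\<Sum>i\<in>A. real (counter (\<lambda>l. X l \<omega>) i m)) \<ge> real m * (\<Sum>i\<in>A. \<mu> i) + \<epsilon>}
           \<le> exp (- 2 * \<epsilon>\<^sup>2 / real m)"
proof -
  interpret prob_space M
    using arr by (simp add: multinomial_arrivals_def)
  have ind: "indep_vars (\<lambda>_. count_space {1..k}) X {1..}"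
    and pr: "\<And>l i. l \<ge> 1 \<Longrightarrow> i \<in> {1..k} \<Longrightarrow> prob {\<omega> \<in> space M. X l \<omega> = i} = \<mu> i"
    using arr by (auto simp: multinomial_arrivals_def)
  define Y where "Y l \<omega> = (indicator A (X l \<omega>) :: real)" for l \<omega>
  have "indep_vars (\<lambda>_. borel) Y {1..}"
    unfolding Y_def by (rule indep_vars_compose2[OF ind]) simp
  then have indY: "indep_vars (\<lambda>_. borel) Y {1..m}"
    by (rule indep_vars_subset) auto
  \<comment> \<open>Each \<open>Y l\<close> has range in [0,1], so the squared widths in Hoeffding's
    exponent add up to \<open>m\<close>.\<close>
  interpret Hoeffding_ineq M "{1..m}" Y "\<lambda>_. 0" "\<lambda>_. 1" "\<Sum>l\<in>{1..m}. expectation (Y l)"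
  proof unfold_locales
    show "indep_vars (\<lambda>_. borel) Y {1..m}" by (rule indY)
  qed (auto simp: Y_def indicator_def)
  have finA: "finite A"
    using A by (rule finite_subset) simp
  have exp: "expectation (Y l) = (\<Sum>i\<in>A. \<mu> i)" if l: "l \<ge> 1" for l
  proof -
    have X: "X l \<in> M \<rightarrow>\<^sub>M count_space {1..k}"
      using ind l by (auto simp: indep_vars_def)
    have ev: "{\<omega> \<in> space M. X l \<omega> = i} \<in> events" if "i \<in> {1..k}" for i
    proof -
      have "{\<omega> \<in> space M. X l \<omega> = i} = X l -` {i} \<inter> space M" by auto
      then show ?thesis
        using measurable_sets[OF X, of "{i}"] that by simp
    qed
    have "expectation (Y l) = expectation (\<lambda>\<omega>. \<Sum>i\<in>A. indicator {\<omega> \<in> space M. X l \<omega> = i} \<omega>)"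
      using finA by (intro Bochner_Integration.integral_cong) (auto simp: Y_def indicator_def sum.delta)
    also have "\<dots> = (\<Sum>i\<in>A. prob {\<omega> \<in> space M. X l \<omega> = i})"
      using ev A by (subst Bochner_Integration.integral_sum)
        (auto simp: subset_eq less_top[symmetric] intro!: sum.cong)
    also have "\<dots> = (\<Sum>i\<in>A. \<mu> i)"
      using pr l A by (intro sum.cong) auto
    finally show ?thesis .
  qed
  have "(\<Sum>l\<in>{1..m}. expectation (Y l)) = real m * (\<Sum>i\<in>A. \<mu> i)"
    using exp by simp
  then show ?thesis
    using Hoeffding_ineq_ge[of \<epsilon>] assms(3,4) sum_counter[OF finA]
    by (simp add: Y_def)
qed

text \<open>A property of the first \<open>m\<close> arrivals factors through a random element of a
  finite discrete space, where every subset is measurable. The restriction in \<open>Z\<close> is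
  undefined outside \<open>{1..m}\<close>, which \<open>cong\<close> lets \<open>P\<close>
  ignore.\<close>

lemma arrivals_event_measurable:
  assumes arr: "multinomial_arrivals M k \<mu> X"
    and cong: "\<And>x y. (\<And>l. l \<in> {1..m} \<Longrightarrow> x l = y l) \<Longrightarrow> P x = P y"
  shows "{\<omega> \<in> space M. P (\<lambda>l. X l \<omega>)} \<in> sets M"
proof -
  define Z where "Z \<omega> = (\<lambda>l\<in>{1..m}. X l \<omega>)" for \<omega>
  interpret prob_space M
    using arr by (simp add: multinomial_arrivals_def)
  have X: "X l \<in> M \<rightarrow>\<^sub>M count_space {1..k}" if "l \<in> {1..m}" for l
    using arr that by (auto simp: multinomial_arrivals_def indep_vars_def)
  have "Z \<in> M \<rightarrow>\<^sub>M PiM {1..m} (\<lambda>_. count_space {1..k})"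
    unfolding Z_def using X by (intro measurable_restrict)
  then have Z: "Z \<in> M \<rightarrow>\<^sub>M count_space (PiE {1..m} (\<lambda>_. {1..k}))"
    by (subst (asm) count_space_PiM_finite) auto
  have "P (\<lambda>l. X l \<omega>) = P (Z \<omega>)" for \<omega>
    by (rule cong) (simp add: Z_def)
  then have "{\<omega> \<in> space M. P (\<lambda>l. X l \<omega>)} = Z -` {z \<in> PiE {1..m} (\<lambda>_. {1..k}). P z} \<inter> space M"
    using measurable_space[OF Z] by auto
  also have "\<dots> \<in> sets M"
    by (rule measurable_sets[OF Z]) auto
  finally show ?thesis .
qed

text \<open>Used with \<open>Q\<close> = k ln(k/\<delta>), \<open>u\<close> = sqrt(N
  \<open>Q\<close>) and \<open>p\<close> = k. Then \<open>c * u / 2 - p\<close> is the deviation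
  \<epsilon>, and the second claim reads t \<open>Q\<close> \<le> 2 \<epsilon>^2, so Hoeffding's
  exponent is at least \<open>Q\<close>.\<close>

lemma excess_quadratic:
  fixes c u Q p :: real
  assumes c: "c = sqrt 2 + 2 / 3" and Q: "Q > 0" and p: "p \<le> 3 / 2 * Q" and u: "u > sqrt 2 * c * Q"
  shows "c * u / 2 - p > 0" and "(u\<^sup>2 - c * u * Q) / 2 \<le> (c * u / 2 - p)\<^sup>2"
proof -
  have s2: "sqrt 2 * sqrt 2 = (2::real)" by simp
  have s: "sqrt 2 > (7/5::real)" by (rule real_less_rsqrt) (simp add: power2_eq_square)
  have c2: "c * c = 22 / 9 + 4 / 3 * sqrt 2"
    unfolding c using s2 by (simp add: algebra_simps)
  have "c * u > c * (sqrt 2 * c * Q)"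
    using c u s by (intro mult_strict_left_mono) auto
  also have "c * (sqrt 2 * c * Q) = (22 / 9 * sqrt 2 + 8 / 3) * Q"
    using c2 s2 by algebra
  finally have "c * u > (22 / 9 * sqrt 2 + 8 / 3) * Q" .
  moreover have "(22 / 9 * sqrt 2 + 8 / 3) * Q \<ge> 3 * Q"
    using s Q by (intro mult_right_mono) auto
  ultimately have cu: "c * u > 3 * Q"
    by linarith
  then show "c * u / 2 - p > 0"
    using p by simp
  have "(c * u / 2 - 3 / 2 * Q)\<^sup>2 \<le> (c * u / 2 - p)\<^sup>2"
    using cu p by (intro power_mono) auto
  moreover have "(u\<^sup>2 - c * u * Q) / 2 \<le> (c * u / 2 - 3 / 2 * Q)\<^sup>2"
  proof -
    \<comment> \<open>Completing the square in \<open>Q\<close> leaves a multiple of u^2 whose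
      coefficient is positive because c^2 > 18/5.\<close>
    have "4 * ((c * u / 2 - 3 / 2 * Q)\<^sup>2 - (u\<^sup>2 - c * u * Q) / 2)
            = (c * c - 2) * u\<^sup>2 - 4 * c * u * Q + 9 * Q\<^sup>2"
      by (simp add: field_simps power2_eq_square)
    also have "\<dots> = (3 * Q - 2 / 3 * c * u)\<^sup>2 + (5 / 9 * (c * c) - 2) * u\<^sup>2"
      by (simp add: field_simps power2_eq_square)
    also have "\<dots> \<ge> 0"
      using s c2 by (intro add_nonneg_nonneg mult_nonneg_nonneg) auto
    finally show ?thesis by simp
  qed
  ultimately show "(u\<^sup>2 - c * u * Q) / 2 \<le> (c * u / 2 - p)\<^sup>2"
    by linarith
qed

section \<open>The probability bound for one round\<close>

theorem theorem4p6:
  fixes M :: "'a measure" and X :: "nat \<Rightarrow> 'a \<Rightarrow> nat" and \<mu> :: "nat \<Rightarrow> real"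
    and k N :: nat and \<delta> \<beta> t :: real
  assumes "k \<ge> 1"
    and "0 < \<delta>" and "\<delta> < 1"
    and "multinomial_arrivals M k \<mu> X"
    and "\<beta> = 2 * (sqrt 2 + 2 / 3)^2"
    and "real N > \<beta> * real k * ln (real k / \<delta>)"
    and "t = real N - (sqrt 2 + 2 / 3) * sqrt (real k * real N * ln (real k / \<delta>))"
  shows "measure M {\<omega> \<in> space M.
           finite (notifications k (baseline \<mu> t) (slack k N t) (\<lambda>m. X m \<omega>) (nat \<lfloor>t\<rfloor>)) \<and>
           card (notifications k (baseline \<mu> t) (slack k N t) (\<lambda>m. X m \<omega>) (nat \<lfloor>t\<rfloor>)) < k}
         \<ge> 1 - \<delta>"
proof -
  note arr = assms(4)
  interpret prob_space M
    using arr by (simp add: multinomial_arrivals_def)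
  have \<mu>: "\<And>i. i \<in> {1..k} \<Longrightarrow> \<mu> i \<ge> 0" "(\<Sum>i\<in>{1..k}. \<mu> i) = 1"
    using arr by (auto simp: multinomial_arrivals_def)
  define L where "L = ln (real k / \<delta>)"
  define Q where "Q = real k * L"
  define c where "c = sqrt 2 + (2 / 3 :: real)"
  define u where "u = sqrt (real N * Q)"
  define m where "m = nat \<lfloor>t\<rfloor>"
  define s where "s = slack k N t"
  define b where "b = baseline \<mu> t"
  let ?few = "\<lambda>x. finite (notifications k b s x m) \<and> card (notifications k b s x m) < k"
  have k\<delta>: "real k / \<delta> > 1"
    using assms(1-3) by (simp add: field_simps)
  then have L: "L > 0"
    by (simp add: L_def)
  then have Q: "Q > 0"
    using assms(1) by (simp add: Q_def)
  have c: "c > 0"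
    by (simp add: c_def add_pos_pos)
  have N: "real N > 2 * c\<^sup>2 * Q"
    using assms(5,6) by (simp add: c_def Q_def L_def mult_ac)
  have u2: "u\<^sup>2 = real N * Q"
    using Q by (simp add: u_def)
  \<comment> \<open>Since \<beta> = 2 c^2, the lower bound on \<open>N\<close> is exactly what gives
    this bound on \<open>u\<close>.\<close>
  have "(sqrt 2 * c * Q)\<^sup>2 = 2 * c\<^sup>2 * Q * Q"
    by (simp add: power2_eq_square)
  also have "\<dots> < real N * Q"
    using N Q by simp
  finally have u: "u > sqrt 2 * c * Q"
    unfolding u_def by (rule real_less_rsqrt)
  have t: "t = real N - c * u"
    using assms(7) by (simp add: c_def u_def Q_def L_def mult_ac)
  have tQ: "t * Q = u\<^sup>2 - c * u * Q"
    unfolding u2 t by (simp add: algebra_simps)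
  have "u\<^sup>2 - c * u * Q = u * (u - c * Q)"
    by (simp add: algebra_simps power2_eq_square)
  also have "\<dots> > 0"
  proof (rule mult_pos_pos)
    have "c * Q < sqrt 2 * (c * Q)" using c Q by simp
    then show "u - c * Q > 0" using u by (simp add: mult_ac)
    moreover have "c * Q > 0" using c Q by simp
    ultimately show "u > 0" by linarith
  qed
  finally have "t > 0"
    using tQ Q by (metis zero_less_mult_pos2)
  then have mt: "real m \<le> t"
    by (simp add: m_def)
  show ?thesis
  \<comment> \<open>These cases are split off because the final estimate 2\<delta>/k \<le> \<delta>
    needs k \<ge> 2 and Hoeffding's exponent divides by \<open>m\<close>. In both, no counter
    exceeds its baseline.\<close>
  proof (cases "k = 1 \<or> m = 0")
    case True
    have "counter x i m \<le> b i" if "i \<in> {1..k}" for i x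
    proof (cases "m = 0")
      case True
      then show ?thesis
        using \<open>t > 0\<close> \<mu>(1)[OF that] by (simp add: counter_def b_def baseline_def)
    next
      case False
      then have "k = 1" "i = 1" using \<open>k = 1 \<or> m = 0\<close> that by auto
      then have "b i = t" using \<mu>(2) by (simp add: b_def baseline_def)
      then show ?thesis
        using counter_le[of x i m] mt by linarith
    qed
    then have "\<not> b i < real (counter x i m)" if "i \<in> {1..k}" for i x
      using that by (simp add: not_less)
    then have "notifications k b s x m = {}" for x
      using notification_dueD[of _ _ k b s x m]
      by (fastforce simp: notification_due_def notifications_def)
    then show ?thesis
      using assms(1,2) by (simp add: b_def s_def m_def prob_space)
  next
    case False
    then have k: "k \<ge> 2" and m: "m \<ge> 1"
      using assms(1) by auto
    have "ln 2 \<le> L"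
      unfolding L_def using k assms(2,3) by (intro ln_mono) (auto simp: field_simps)
    then have "2 / 3 \<le> L"
      using ln2_ge_two_thirds by linarith
    then have kQ: "real k \<le> 3 / 2 * Q"
      using k by (simp add: Q_def field_simps)
    \<comment> \<open>This is (N - t)/2 - k: rounding the slack down costs less than 1 per unit of
      \<open>s\<close>, hence less than \<open>k\<close> in \<open>k * s\<close>.\<close>
    define \<epsilon> where "\<epsilon> = c * u / 2 - real k"
    note quad = excess_quadratic[OF c_def Q kQ u, folded \<epsilon>_def tQ]
    have "(real N - t) / (2 * real k) < real_of_int s + 1"
      by (simp add: s_def slack_def)
    then have ks: "\<epsilon> < real k * of_int s"
      using k by (simp add: t \<epsilon>_def field_simps)
    \<comment> \<open>Positivity of \<epsilon> rules out the degenerate zero slack.\<close>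
    then have s: "s > 0"
      using quad(1) k by (smt (verit) mult_nonneg_nonpos of_int_0_less_iff of_nat_0_le_iff)
    define Bad where "Bad A = {\<omega> \<in> space M. (\<Sum>i\<in>A. real (counter (\<lambda>l. X l \<omega>) i m))
                                 \<ge> real m * (\<Sum>i\<in>A. \<mu> i) + \<epsilon>}" for A
    have Bad_ev: "Bad A \<in> events" for A
      unfolding Bad_def
    proof (rule arrivals_event_measurable[OF arr, of m], goal_cases)
      case (1 x y)
      then have "counter x i m = counter y i m" for i
        using counter_cong[of m x y m] by blast
      then show ?case by simp
    qed
    have few_ev: "{\<omega> \<in> space M. ?few (\<lambda>l. X l \<omega>)} \<in> events"
    proof (rule arrivals_event_measurable[OF arr, of m], goal_cases)
      case (1 x y)
      then show ?case using notifications_cong[of m x y] by simp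
    qed
    have "Q * real m \<le> Q * t"
      using Q mt by simp
    then have "Q \<le> 2 * \<epsilon>\<^sup>2 / real m"
      using quad(2) m by (simp add: field_simps)
    then have tail: "exp (- 2 * \<epsilon>\<^sup>2 / real m) \<le> exp (- Q)"
      by simp
    have expQ: "exp (- Q) = (\<delta> / real k) ^ k"
    proof -
      have "exp (- L) = \<delta> / real k"
        using k\<delta> by (simp add: L_def exp_minus)
      then show ?thesis
        using exp_of_nat_mult[of k "- L"] by (simp add: Q_def)
    qed
    \<comment> \<open>The set of players above baseline is random, so all 2^k candidates are
      excluded at once.\<close>
    have "prob (\<Union>A\<in>Pow {1..k}. Bad A) \<le> (\<Sum>A\<in>Pow {1..k}. prob (Bad A))"
      using Bad_ev by (intro finite_measure_subadditive_finite) auto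
    also have "\<dots> \<le> (\<Sum>A\<in>Pow {1..k}. exp (- Q))"
      using multinomial_arrivals_tail[OF arr _ _ m, of _ \<epsilon>] quad(1) tail
      by (intro sum_mono order.trans[OF _ tail]) (simp add: Bad_def)
    also have "\<dots> = (2 * \<delta> / real k) ^ k"
      by (simp add: card_Pow expQ power_mult_distrib power_divide)
    also have "\<dots> \<le> \<delta> ^ k"
      using k assms(2) by (intro power_mono) (auto simp: field_simps)
    also have "\<dots> \<le> \<delta>"
      using power_decreasing[of 1 k \<delta>] assms(1-3) by simp
    finally have "1 - \<delta> \<le> prob (space M - (\<Union>A\<in>Pow {1..k}. Bad A))"
      using Bad_ev by (subst prob_compl) auto
    also have "\<dots> \<le> prob {\<omega> \<in> space M. ?few (\<lambda>l. X l \<omega>)}"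
    proof (rule finite_measure_mono[OF _ few_ev], clarify)
      fix \<omega> assume \<omega>: "\<omega> \<in> space M" "\<omega> \<notin> (\<Union>A\<in>Pow {1..k}. Bad A)"
      have "(\<Sum>i\<in>A. real (counter (\<lambda>l. X l \<omega>) i m) - b i) < real k * of_int s" if A: "A \<subseteq> {1..k}" for A
      proof -
        \<comment> \<open>Baselines use \<open>t\<close> while the expected load uses
          \<open>m\<close>; as \<open>m\<close> \<le> \<open>t\<close>, an excess over the baselines
          is also one over the mean.\<close>
        have "(\<Sum>i\<in>A. \<mu> i) \<ge> 0"
          using \<mu>(1) A by (intro sum_nonneg) auto
        then have "real m * (\<Sum>i\<in>A. \<mu> i) \<le> t * (\<Sum>i\<in>A. \<mu> i)"
          using mt by (rule mult_right_mono[rotated])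
        also have "\<dots> = (\<Sum>i\<in>A. b i)"
          by (simp add: b_def baseline_def sum_distrib_left mult.commute)
        finally have "real m * (\<Sum>i\<in>A. \<mu> i) \<le> (\<Sum>i\<in>A. b i)" .
        moreover have "(\<Sum>i\<in>A. real (counter (\<lambda>l. X l \<omega>) i m)) < real m * (\<Sum>i\<in>A. \<mu> i) + \<epsilon>"
        proof -
          have "\<omega> \<notin> Bad A" using \<omega>(2) A by blast
          then show ?thesis using \<omega>(1) by (simp add: Bad_def not_le)
        qed
        ultimately show ?thesis
          using ks by (simp add: sum_subtractf)
      qed
      then show "?few (\<lambda>l. X l \<omega>)"
        by (rule few_notifications[OF s])
    qed
    finally show ?thesis
      by (simp add: b_def s_def m_def)
  qed
qed

end
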